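(* Let $(e^{tA})_{t\ge 0}$ be a $C_0$-semigroup on a (real or complex) Banach lattice $E$ and let $B$ be a bounded linear operator on $E$. If $e^{tA}Be^{sA}\ge 0$ for all $s,t\ge 0$, then $e^{t(A+B)}-e^{tA}\ge 0$ for all $t\ge 0$.
   Context: For a bounded linear operator $T$ on a Banach lattice $E$ with positive cone $E_+$, $T\ge 0$ means $T(E_+)\subseteq E_+$. $(e^{t(A+B)})_{t\ge 0}$ denotes the $C_0$-semigroup generated by $A+B$ (with the domain of $A$). *)

theory Defs
  imports "HOL-Analysis.Analysis" "HOL-Library.Lattice_Algebras"
begin

section \<open>Real Banach lattices\<close>

class banach_lattice = banach + ordered_real_vector + lattice_ab_group_add_abs +
  assumes norm_mono_abs: "\<bar>x\<bar> \<le> \<bar>y\<bar> \<Longrightarrow> norm x \<le> norm y"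

instance real :: banach_lattice
  by standard simp

lemma norm_mono_nonneg:
  fixes x y :: "'a::banach_lattice"
  shows "0 \<le> x \<Longrightarrow> x \<le> y \<Longrightarrow> norm x \<le> norm y"
  by (rule norm_mono_abs) simp

lemma norm_abs_banach_lattice:
  fixes x :: "'a::banach_lattice"
  shows "norm \<bar>x\<bar> = norm x"
  by (intro antisym norm_mono_abs) simp_all

lemma closed_nonneg_banach_lattice: "closed {x::'a::banach_lattice. 0 \<le> x}"
proof (unfold closed_sequential_limits, intro allI impI)
  fix X :: "nat \<Rightarrow> 'a" and l
  assume "(\<forall>n. X n \<in> {x. 0 \<le> x}) \<and> X \<longlonglongrightarrow> l"
  then have X: "\<And>n. 0 \<le> X n" and lim: "X \<longlonglongrightarrow> l" by auto
  have bound: "norm (sup (- l) 0) \<le> norm (X n - l)" for n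
  proof -
    have "- l = - X n + (X n - l)" by simp
    also have "\<dots> \<le> 0 + \<bar>X n - l\<bar>" using X by (intro add_mono) (simp_all add: abs_ge_self)
    finally have "sup (- l) 0 \<le> \<bar>X n - l\<bar>" by simp
    then have "norm (sup (- l) 0) \<le> norm \<bar>X n - l\<bar>" by (intro norm_mono_nonneg) simp_all
    then show ?thesis by (simp add: norm_abs_banach_lattice)
  qed
  have "(\<lambda>n. norm (X n - l)) \<longlonglongrightarrow> 0" using lim by (simp add: LIM_zero tendsto_norm_zero)
  then have "norm (sup (- l) 0) \<le> 0" by (rule LIMSEQ_le_const) (use bound in auto)
  then have "sup (- l) 0 = 0" by simp
  then have "- l \<le> 0" by (metis sup.cobounded1)
  then show "l \<in> {x. 0 \<le> x}" by simp
qed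

lemma banach_lattice_lim_mono:
  fixes X Y :: "nat \<Rightarrow> 'a::banach_lattice"
  assumes "X \<longlonglongrightarrow> l" "Y \<longlonglongrightarrow> m" "\<And>n. X n \<le> Y n"
  shows "l \<le> m"
proof -
  have "m - l \<in> {x. 0 \<le> x}"
    by (rule closed_sequentially[OF closed_nonneg_banach_lattice, of "\<lambda>n. Y n - X n"])
       (use assms in \<open>auto intro: tendsto_diff\<close>)
  then show ?thesis by simp
qed


section \<open>Complex Banach lattices\<close>

text \<open>A complex Banach lattice is the complexification \<open>E + i E\<close> of a real Banach lattice \<open>E\<close>,
  normed by \<open>z \<mapsto> \<parallel> |z| \<parallel>\<close>, where \<open>|x + i y| = sup {cos \<theta> x + sin \<theta> y | \<theta>}\<close>.\<close>

datatype 'a complexification = Cpl (re_part: 'a) (im_part: 'a)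

text \<open>The \<open>LEAST\<close> upper bound is the supremum; see \<open>modulus_lub\<close> below for its existence.\<close>

definition modulus :: "'a::banach_lattice complexification \<Rightarrow> 'a" where
  "modulus z = (LEAST m. \<forall>\<theta>::real. cos \<theta> *\<^sub>R re_part z + sin \<theta> *\<^sub>R im_part z \<le> m)"

definition scaleC :: "complex \<Rightarrow> 'a::real_vector complexification \<Rightarrow> 'a complexification" where
  "scaleC c z = Cpl (Re c *\<^sub>R re_part z - Im c *\<^sub>R im_part z) (Re c *\<^sub>R im_part z + Im c *\<^sub>R re_part z)"

lemma rot_diff_le:
  fixes x y :: "'a::banach_lattice" and s t :: real
  shows "cos s *\<^sub>R x + sin s *\<^sub>R y \<le> cos t *\<^sub>R x + sin t *\<^sub>R y + \<bar>s - t\<bar> *\<^sub>R (\<bar>x\<bar> + \<bar>y\<bar>)"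
proof -
  have le: "a *\<^sub>R v \<le> b *\<^sub>R \<bar>v\<bar>" if "\<bar>a\<bar> \<le> b" for a b :: real and v :: 'a
  proof -
    have "a *\<^sub>R v \<le> \<bar>a\<bar> *\<^sub>R \<bar>v\<bar>"
    proof (cases "0 \<le> a")
      case True
      then show ?thesis by (simp add: scaleR_left_mono abs_ge_self)
    next
      case False
      then have "(- a) *\<^sub>R (- v) \<le> (- a) *\<^sub>R \<bar>v\<bar>" by (intro scaleR_left_mono) (simp_all add: abs_ge_minus_self)
      then show ?thesis using False by simp
    qed
    also have "\<dots> \<le> b *\<^sub>R \<bar>v\<bar>" using that by (intro scaleR_right_mono) simp_all
    finally show ?thesis .
  qed
  have lip: "\<bar>cos s - cos t\<bar> \<le> \<bar>s - t\<bar>" "\<bar>sin s - sin t\<bar> \<le> \<bar>s - t\<bar>"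
  proof -
    have h: "\<bar>sin ((s - t) / 2)\<bar> \<le> \<bar>s - t\<bar> / 2" using abs_sin_x_le_abs_x[of "(s - t) / 2"] by simp
    have h': "\<bar>sin ((t - s) / 2)\<bar> \<le> \<bar>s - t\<bar> / 2" using abs_sin_x_le_abs_x[of "(t - s) / 2"] by simp
    have "\<bar>cos s - cos t\<bar> = 2 * \<bar>sin ((s + t) / 2)\<bar> * \<bar>sin ((t - s) / 2)\<bar>"
      using cos_diff_cos[of s t] by (simp add: abs_mult)
    also have "\<dots> \<le> 2 * 1 * (\<bar>s - t\<bar> / 2)" using h' by (intro mult_mono) auto
    finally show "\<bar>cos s - cos t\<bar> \<le> \<bar>s - t\<bar>" by simp
    have "\<bar>sin s - sin t\<bar> = 2 * \<bar>sin ((s - t) / 2)\<bar> * \<bar>cos ((s + t) / 2)\<bar>"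
      using sin_diff_sin[of s t] by (simp add: abs_mult)
    also have "\<dots> \<le> 2 * (\<bar>s - t\<bar> / 2) * 1" using h by (intro mult_mono) auto
    finally show "\<bar>sin s - sin t\<bar> \<le> \<bar>s - t\<bar>" by simp
  qed
  have "(cos s - cos t) *\<^sub>R x + (sin s - sin t) *\<^sub>R y \<le> \<bar>s - t\<bar> *\<^sub>R \<bar>x\<bar> + \<bar>s - t\<bar> *\<^sub>R \<bar>y\<bar>"
    by (intro add_mono le lip)
  then show ?thesis by (simp add: algebra_simps)
qed

lemma modulus_exists:
  fixes x y :: "'a::banach_lattice"
  shows "\<exists>m. (\<forall>\<theta>::real. cos \<theta> *\<^sub>R x + sin \<theta> *\<^sub>R y \<le> m) \<and>
             (\<forall>w. (\<forall>\<theta>::real. cos \<theta> *\<^sub>R x + sin \<theta> *\<^sub>R y \<le> w) \<longrightarrow> m \<le> w)"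
proof -
  define f where "f = (\<lambda>t::real. cos t *\<^sub>R x + sin t *\<^sub>R y)"
  define u where "u = \<bar>x\<bar> + \<bar>y\<bar>"
  have u0: "0 \<le> u" by (simp add: u_def)
  define e where "e = (\<lambda>n::nat. inverse (real (Suc n)))"
  define G where "G = (\<lambda>n. f ` (\<lambda>k::nat. real k * e n) ` {..7 * Suc n})"
  define M where "M = (\<lambda>n. Sup_fin (G n))"
  have G: "finite (G n)" "G n \<noteq> {}" for n by (auto simp: G_def)
  have e0: "0 < e n" for n by (simp add: e_def)
  have elim: "e \<longlonglongrightarrow> 0" unfolding e_def by (rule LIMSEQ_inverse_real_of_nat)
  have fM: "f t \<le> M n + e n *\<^sub>R u" for t n
  proof -
    obtain s where s: "0 \<le> s" "s < 2 * pi" "cos t = cos s" "sin t = sin s"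
    proof -
      obtain s where "0 \<le> s" "s < 2 * pi" "sin s = sin t \<and> cos s = cos t"
        using sincos_total_2pi[of "cos t" "sin t"] sin_cos_squared_add[of t]
        by (metis add.commute)
      then show ?thesis using that by simp
    qed
    have s7: "s < 7" using s(2) pi_less_4 pi_approx by simp
    define k where "k = nat \<lfloor>s * real (Suc n)\<rfloor>"
    have k: "real k \<le> s * real (Suc n)" "s * real (Suc n) < real k + 1"
      using s(1) by (simp_all add: k_def)
    have "real k \<le> 7 * real (Suc n)" using k(1) mult_right_mono[of s 7 "real (Suc n)"] s7 by simp
    then have "k \<le> 7 * Suc n" by (metis of_nat_le_iff of_nat_mult of_nat_numeral)
    then have "f (real k * e n) \<in> G n" unfolding G_def by blast
    then have le: "f (real k * e n) \<le> M n" unfolding M_def using G by (intro Sup_fin.coboundedI)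
    have d: "\<bar>s - real k * e n\<bar> \<le> e n"
    proof -
      have a: "s = (s * real (Suc n)) * e n" by (simp add: e_def)
      have "s - real k * e n = (s * real (Suc n) - real k) * e n" using a by (simp add: algebra_simps)
      moreover have "\<bar>(s * real (Suc n) - real k) * e n\<bar> \<le> 1 * e n"
        unfolding abs_mult using k e0[of n] by (intro mult_mono) auto
      ultimately show ?thesis by simp
    qed
    have "f t = f s" using s by (simp add: f_def)
    also have "\<dots> \<le> f (real k * e n) + \<bar>s - real k * e n\<bar> *\<^sub>R u"
      unfolding f_def u_def by (rule rot_diff_le)
    also have "\<dots> \<le> M n + e n *\<^sub>R u" using le d u0 by (intro add_mono scaleR_right_mono)
    finally show ?thesis .
  qed
  have Mle: "M n \<le> w" if "\<And>t. f t \<le> w" for n w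
    unfolding M_def using G that by (intro Sup_fin.boundedI) (auto simp: G_def)
  have MM: "norm (M m - M n) \<le> (e m + e n) * norm u" for m n
  proof -
    have 1: "M m - M n \<le> (e m + e n) *\<^sub>R u" for m n
    proof -
      have "M m \<le> M n + e n *\<^sub>R u" by (rule Mle) (rule fM)
      also have "\<dots> \<le> M n + (e m + e n) *\<^sub>R u"
        using e0[of m] u0 by (intro add_left_mono scaleR_right_mono) auto
      finally show ?thesis by (simp add: algebra_simps)
    qed
    have "\<bar>M m - M n\<bar> \<le> (e m + e n) *\<^sub>R u"
      using 1[of m n] 1[of n m] by (intro abs_leI) (simp_all add: add.commute)
    then have "norm \<bar>M m - M n\<bar> \<le> norm ((e m + e n) *\<^sub>R u)" by (intro norm_mono_nonneg) simp_all
    then show ?thesis using e0[of m] e0[of n] by (simp add: norm_abs_banach_lattice)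
  qed
  have "Cauchy M"
  proof (rule metric_CauchyI)
    fix r :: real assume r: "0 < r"
    have "(\<lambda>n. e n * (2 * (norm u + 1))) \<longlonglongrightarrow> 0" using tendsto_mult_left_zero[OF elim] by simp
    then have "eventually (\<lambda>n. e n * (2 * (norm u + 1)) < r) sequentially"
      using r by (rule order_tendstoD)
    then obtain N where N: "e N * (2 * (norm u + 1)) < r" by (auto simp: eventually_sequentially)
    have dec: "e n \<le> e N" if "N \<le> n" for n using that by (simp add: e_def field_simps)
    have "dist (M m) (M n) < r" if "N \<le> m" "N \<le> n" for m n
    proof -
      have "norm (M m - M n) \<le> (e m + e n) * norm u" by (rule MM)
      also have "\<dots> \<le> (2 * e N) * (norm u + 1)"
        using dec[OF that(1)] dec[OF that(2)] e0[of N] by (intro mult_mono) auto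
      also have "\<dots> < r" using N by (simp add: ac_simps)
      finally show ?thesis by (simp add: dist_norm)
    qed
    then show "\<exists>N. \<forall>m\<ge>N. \<forall>n\<ge>N. dist (M m) (M n) < r" by blast
  qed
  then obtain m where m: "M \<longlonglongrightarrow> m" using Cauchy_convergent convergent_def by blast
  have lim: "(\<lambda>n. M n + e n *\<^sub>R u) \<longlonglongrightarrow> m"
    using tendsto_add[OF m tendsto_scaleR[OF elim tendsto_const[of u]]] by simp
  have "f t \<le> m" for t by (rule banach_lattice_lim_mono[OF tendsto_const lim]) (rule fM)
  moreover have "m \<le> w" if "\<And>t. f t \<le> w" for w
    by (rule banach_lattice_lim_mono[OF m tendsto_const]) (rule Mle, rule that)
  ultimately show ?thesis unfolding f_def by blast
qed

lemma modulus_lub: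
  shows modulus_upper: "cos \<theta> *\<^sub>R re_part z + sin \<theta> *\<^sub>R im_part z \<le> modulus z"
    and modulus_least:
      "(\<And>t::real. cos t *\<^sub>R re_part z + sin t *\<^sub>R im_part z \<le> w) \<Longrightarrow> modulus z \<le> w"
proof -
  obtain m where m: "\<forall>\<theta>::real. cos \<theta> *\<^sub>R re_part z + sin \<theta> *\<^sub>R im_part z \<le> m"
    "\<And>w. \<forall>\<theta>::real. cos \<theta> *\<^sub>R re_part z + sin \<theta> *\<^sub>R im_part z \<le> w \<Longrightarrow> m \<le> w"
    using modulus_exists[of "re_part z" "im_part z"] by blast
  have eq: "modulus z = m" unfolding modulus_def by (rule Least_equality) (use m in blast)+
  show "cos \<theta> *\<^sub>R re_part z + sin \<theta> *\<^sub>R im_part z \<le> modulus z" using m(1) eq by simp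
  show "modulus z \<le> w" if "\<And>t::real. cos t *\<^sub>R re_part z + sin t *\<^sub>R im_part z \<le> w"
    using m(2) that eq by simp
qed

lemma abs_re_le_modulus: "\<bar>re_part z\<bar> \<le> modulus z"
  using modulus_upper[of 0 z] modulus_upper[of pi z] by (intro abs_leI) simp_all

lemma abs_im_le_modulus: "\<bar>im_part z\<bar> \<le> modulus z"
  using modulus_upper[of "pi/2" z] modulus_upper[of "- (pi/2)" z] by (intro abs_leI) simp_all

lemma modulus_nonneg: "0 \<le> modulus z"
  using abs_re_le_modulus[of z] abs_ge_zero order_trans by blast

lemma modulus_le_abs: "modulus z \<le> \<bar>re_part z\<bar> + \<bar>im_part z\<bar>"
proof (rule modulus_least)
  fix t :: real
  have le: "a *\<^sub>R v \<le> \<bar>v\<bar>" if "\<bar>a\<bar> \<le> 1" for a :: real and v :: 'a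
  proof (cases "0 \<le> a")
    case True
    then have "a *\<^sub>R v \<le> a *\<^sub>R \<bar>v\<bar>" by (simp add: scaleR_left_mono abs_ge_self)
    also have "\<dots> \<le> 1 *\<^sub>R \<bar>v\<bar>" using that by (intro scaleR_right_mono) simp_all
    finally show ?thesis by simp
  next
    case False
    then have "(- a) *\<^sub>R (- v) \<le> (- a) *\<^sub>R \<bar>v\<bar>" by (intro scaleR_left_mono) (simp_all add: abs_ge_minus_self)
    also have "\<dots> \<le> 1 *\<^sub>R \<bar>v\<bar>" using that by (intro scaleR_right_mono) simp_all
    finally show ?thesis by simp
  qed
  show "cos t *\<^sub>R re_part z + sin t *\<^sub>R im_part z \<le> \<bar>re_part z\<bar> + \<bar>im_part z\<bar>"
    by (intro add_mono le) simp_all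
qed

lemma modulus_scaleC: "modulus (scaleC c z) = cmod c *\<^sub>R modulus z"
proof -
  have le: "modulus (scaleC c z) \<le> cmod c *\<^sub>R modulus z" for c and z :: "'a complexification"
  proof (rule modulus_least)
    fix t :: real
    define a where "a = Arg c"
    have c: "Re c = cmod c * cos a" "Im c = cmod c * sin a"
      using rcis_cmod_Arg[of c] by (metis a_def Re_rcis, metis a_def Im_rcis)
    have "cos t *\<^sub>R re_part (scaleC c z) + sin t *\<^sub>R im_part (scaleC c z) =
        cmod c *\<^sub>R (cos (t - a) *\<^sub>R re_part z + sin (t - a) *\<^sub>R im_part z)"
      by (simp add: scaleC_def c cos_diff sin_diff algebra_simps)
    also have "\<dots> \<le> cmod c *\<^sub>R modulus z" by (intro scaleR_left_mono modulus_upper) simp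
    finally show "cos t *\<^sub>R re_part (scaleC c z) + sin t *\<^sub>R im_part (scaleC c z) \<le> cmod c *\<^sub>R modulus z" .
  qed
  have ge: "cmod c *\<^sub>R modulus z \<le> modulus (scaleC c z)"
  proof (cases "c = 0")
    case True
    then show ?thesis by (simp add: modulus_nonneg)
  next
    case False
    have assoc: "scaleC a (scaleC b z) = scaleC (a * b) z" for a b
      by (simp add: scaleC_def algebra_simps)
    have "scaleC (inverse c) (scaleC c z) = z"
      unfolding assoc using False by (simp add: scaleC_def)
    then have "modulus z \<le> cmod (inverse c) *\<^sub>R modulus (scaleC c z)"
      using le[of "inverse c" "scaleC c z"] by simp
    then have "cmod c *\<^sub>R modulus z \<le> cmod c *\<^sub>R cmod (inverse c) *\<^sub>R modulus (scaleC c z)"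
      by (rule scaleR_left_mono) simp
    then show ?thesis using False by (simp add: norm_inverse)
  qed
  show ?thesis by (rule antisym[OF le ge])
qed

instantiation complexification :: (banach_lattice) real_vector
begin

definition zero_complexification where "(0::'a complexification) = Cpl 0 0"
definition plus_complexification where "(z::'a complexification) + w = Cpl (re_part z + re_part w) (im_part z + im_part w)"
definition uminus_complexification where "- (z::'a complexification) = Cpl (- re_part z) (- im_part z)"
definition minus_complexification where "(z::'a complexification) - w = Cpl (re_part z - re_part w) (im_part z - im_part w)"
definition scaleR_complexification where "r *\<^sub>R (z::'a complexification) = Cpl (r *\<^sub>R re_part z) (r *\<^sub>R im_part z)"

lemmas complexification_ops = zero_complexification_def plus_complexification_def
  uminus_complexification_def minus_complexification_def scaleR_complexification_def

instance
  by standard (simp_all add: complexification_ops complexification.expand algebra_simps)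

end

instantiation complexification :: (banach_lattice) real_normed_vector
begin

definition norm_complexification where "norm (z::'a complexification) = norm (modulus z)"
definition sgn_complexification where "sgn (z::'a complexification) = z /\<^sub>R norm z"
definition dist_complexification where "dist (z::'a complexification) w = norm (z - w)"
definition uniformity_complexification where
  "(uniformity :: ('a complexification \<times> 'a complexification) filter) =
    (INF e\<in>{0 <..}. principal {(x, y). dist x y < e})"
definition open_complexification where
  "open (U :: 'a complexification set) \<longleftrightarrow> (\<forall>x\<in>U. eventually (\<lambda>(x', y). x' = x \<longrightarrow> y \<in> U) uniformity)"

instance
proof
  fix z w :: "'a complexification" and r :: real
  show "(norm z = 0) = (z = 0)"
  proof
    assume "norm z = 0"
    then have "modulus z = 0" by (simp add: norm_complexification_def)
    then have "\<bar>re_part z\<bar> \<le> 0" "\<bar>im_part z\<bar> \<le> 0"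
      using abs_re_le_modulus[of z] abs_im_le_modulus[of z] by simp_all
    then show "z = 0" by (cases z) (simp add: zero_complexification_def)
  next
    assume "z = 0"
    then have "modulus z \<le> 0" using modulus_le_abs[of z] by (simp add: zero_complexification_def)
    then show "norm z = 0" using modulus_nonneg[of z] by (simp add: norm_complexification_def antisym)
  qed
  have "modulus (z + w) \<le> modulus z + modulus w"
  proof (rule modulus_least)
    fix t :: real
    have "cos t *\<^sub>R re_part (z + w) + sin t *\<^sub>R im_part (z + w) =
      (cos t *\<^sub>R re_part z + sin t *\<^sub>R im_part z) + (cos t *\<^sub>R re_part w + sin t *\<^sub>R im_part w)"
      by (simp add: plus_complexification_def algebra_simps)
    also have "\<dots> \<le> modulus z + modulus w" by (intro add_mono modulus_upper)
    finally show "cos t *\<^sub>R re_part (z + w) + sin t *\<^sub>R im_part (z + w) \<le> modulus z + modulus w" .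
  qed
  then have "norm (modulus (z + w)) \<le> norm (modulus z + modulus w)"
    by (intro norm_mono_nonneg modulus_nonneg)
  also have "\<dots> \<le> norm (modulus z) + norm (modulus w)" by (rule norm_triangle_ineq)
  finally show "norm (z + w) \<le> norm z + norm w" by (simp add: norm_complexification_def)
  have "r *\<^sub>R z = scaleC (of_real r) z" by (simp add: scaleC_def scaleR_complexification_def)
  then show "norm (r *\<^sub>R z) = \<bar>r\<bar> * norm z"
    by (simp add: norm_complexification_def modulus_scaleC)
qed (simp_all add: sgn_complexification_def dist_complexification_def
      uniformity_complexification_def open_complexification_def)

end

lemma norm_re_part_le: "norm (re_part z) \<le> norm z"
  using norm_mono_nonneg[OF abs_ge_zero abs_re_le_modulus[of z]]
  by (simp add: norm_complexification_def norm_abs_banach_lattice)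

lemma norm_im_part_le: "norm (im_part z) \<le> norm z"
  using norm_mono_nonneg[OF abs_ge_zero abs_im_le_modulus[of z]]
  by (simp add: norm_complexification_def norm_abs_banach_lattice)

lemma norm_complexification_le: "norm z \<le> norm (re_part z) + norm (im_part z)"
proof -
  have "norm (modulus z) \<le> norm (\<bar>re_part z\<bar> + \<bar>im_part z\<bar>)"
    by (intro norm_mono_nonneg modulus_nonneg modulus_le_abs)
  also have "\<dots> \<le> norm \<bar>re_part z\<bar> + norm \<bar>im_part z\<bar>" by (rule norm_triangle_ineq)
  finally show ?thesis by (simp add: norm_complexification_def norm_abs_banach_lattice)
qed

lemma norm_scaleC: "norm (scaleC c z) = cmod c * norm z"
  by (simp add: norm_complexification_def modulus_scaleC)

instance complexification :: (banach_lattice) banach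
proof
  fix X :: "nat \<Rightarrow> 'a complexification"
  assume X: "Cauchy X"
  have sel: "re_part (z - w) = re_part z - re_part w" "im_part (z - w) = im_part z - im_part w"
    for z w :: "'a complexification" by (simp_all add: minus_complexification_def)
  have d: "dist (re_part z) (re_part w) \<le> dist z w" "dist (im_part z) (im_part w) \<le> dist z w"
    for z w :: "'a complexification"
    unfolding dist_norm sel[symmetric] by (rule norm_re_part_le norm_im_part_le)+
  have "Cauchy (\<lambda>n. re_part (X n))" "Cauchy (\<lambda>n. im_part (X n))"
    using X d unfolding Cauchy_def by (meson le_less_trans)+
  then obtain x y where xy: "(\<lambda>n. re_part (X n)) \<longlonglongrightarrow> x" "(\<lambda>n. im_part (X n)) \<longlonglongrightarrow> y"
    using Cauchy_convergent convergent_def by metis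
  have "(\<lambda>n. norm (re_part (X n) - x) + norm (im_part (X n) - y)) \<longlonglongrightarrow> 0 + 0"
    using xy by (intro tendsto_add) (simp_all add: LIM_zero tendsto_norm_zero)
  then have "(\<lambda>n. norm (re_part (X n) - x) + norm (im_part (X n) - y)) \<longlonglongrightarrow> 0" by simp
  then have "(\<lambda>n. X n - Cpl x y) \<longlonglongrightarrow> 0"
    by (rule Lim_null_comparison[rotated])
       (use norm_complexification_le in \<open>auto simp: sel intro!: always_eventually
          order_trans[OF norm_complexification_le]\<close>)
  then show "convergent X" unfolding convergent_def by (blast intro: LIM_zero_cancel)
qed

text \<open>The order whose positive cone is \<open>E\<^sub>+\<close>, embedded in \<open>E + i E\<close> as a set of real elements.\<close>

instantiation complexification :: (banach_lattice) ordered_real_vector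
begin

definition less_eq_complexification where
  "(z::'a complexification) \<le> w \<longleftrightarrow> re_part z \<le> re_part w \<and> im_part z = im_part w"
definition less_complexification where
  "(z::'a complexification) < w \<longleftrightarrow> z \<le> w \<and> \<not> w \<le> z"

instance
  by standard (auto simp: less_eq_complexification_def less_complexification_def complexification_ops
      intro: complexification.expand scaleR_left_mono scaleR_right_mono)

end


section \<open>Positive operators and semigroups\<close>

definition positive_operator ::
    "'a::{real_normed_vector, ordered_real_vector} \<Rightarrow>\<^sub>L 'a \<Rightarrow> bool" where
  "positive_operator T \<longleftrightarrow> (\<forall>x\<ge>0. 0 \<le> blinfun_apply T x)"

definition complex_linear ::
    "'a::banach_lattice complexification \<Rightarrow>\<^sub>L 'a complexification \<Rightarrow> bool" where
  "complex_linear T \<longleftrightarrow> (\<forall>c z. blinfun_apply T (scaleC c z) = scaleC c (blinfun_apply T z))"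

text \<open>Only the values of \<open>T\<close> at times \<open>t \<ge> 0\<close> are relevant.\<close>

definition C0_semigroup :: "(real \<Rightarrow> 'a::banach \<Rightarrow>\<^sub>L 'a) \<Rightarrow> bool" where
  "C0_semigroup T \<longleftrightarrow>
     T 0 = id_blinfun \<and>
     (\<forall>s\<ge>0. \<forall>t\<ge>0. T (s + t) = T s o\<^sub>L T t) \<and>
     (\<forall>x. continuous_on {0..} (\<lambda>t. blinfun_apply (T t) x))"

text \<open>Unbounded operators are represented by their graphs.\<close>

definition generator :: "(real \<Rightarrow> 'a::banach \<Rightarrow>\<^sub>L 'a) \<Rightarrow> ('a \<times> 'a) set" where
  "generator T =
     {(x, y). ((\<lambda>h. (blinfun_apply (T h) x - x) /\<^sub>R h) \<longlongrightarrow> y) (at_right 0)}"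

definition generates :: "('a::banach \<times> 'a) set \<Rightarrow> (real \<Rightarrow> 'a \<Rightarrow>\<^sub>L 'a) \<Rightarrow> bool" where
  "generates A T \<longleftrightarrow> C0_semigroup T \<and> generator T = A"

definition perturb :: "('a::banach \<times> 'a) set \<Rightarrow> ('a \<Rightarrow>\<^sub>L 'a) \<Rightarrow> ('a \<times> 'a) set" where
  "perturb A B = {(x, y + blinfun_apply B x) | x y. (x, y) \<in> A}"

end

theory Submission
  imports Defs
begin

text \<open>Let \<open>T\<close> and \<open>S\<close> be the semigroups of \<open>A\<close> and \<open>A + B\<close>, and put
  \<open>u(t) = S(t)x - T(t)x\<close> for \<open>x \<ge> 0\<close>. Duhamel's formula reads
  \<open>u(t) = \<integral>\<^sub>0\<^sup>t T(t - s) B T(s) x ds + \<integral>\<^sub>0\<^sup>t T(t - s) B u(s) ds\<close>, where the first integrand is positive and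
  the operators \<open>T(t - s) B = T(t - s) B T(0)\<close> are positive too. A positive operator \<open>K\<close> increases
  the distance \<open>d\<close> to the positive cone at most by the factor \<open>\<parallel>K\<parallel>\<close>, and \<open>d\<close> is sublinear, so
  \<open>d(u(t)) \<le> M \<integral>\<^sub>0\<^sup>t d(u(s)) ds\<close>. Hence \<open>d(u(t)) = 0\<close> as in Gronwall's lemma, and \<open>u(t) \<ge> 0\<close> because
  the cone is closed.\<close>

section \<open>Strongly continuous semigroups\<close>

text \<open>By Baire's theorem one of the closed sets \<open>F n\<close>, which exhaust the space,
  contains a ball \<open>cball a e\<close>. A vector \<open>y\<close> of norm \<open>e\<close> is
  the difference of \<open>a + y\<close> and \<open>a\<close>, both in \<open>F n\<close>, so
  \<open>T i y\<close> has norm at most \<open>2 * n\<close>; scaling gives the bound on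
  \<open>norm (T i)\<close>.\<close>

lemma banach_steinhaus:
  fixes T :: "'i \<Rightarrow> 'a::banach \<Rightarrow>\<^sub>L 'b::real_normed_vector"
  assumes "\<And>x. \<exists>C. \<forall>i\<in>I. norm (T i x) \<le> C"
  shows "\<exists>M. \<forall>i\<in>I. norm (T i) \<le> M"
proof -
  define F where "F n = (\<Inter>i\<in>I. {x. norm (T i x) \<le> real n})" for n :: nat
  have closed: "closed (F n)" for n
    unfolding F_def by (intro closed_INT ballI closed_Collect_le continuous_intros)
  have "(\<Union>n. F n) = UNIV"
  proof -
    have "\<exists>n. x \<in> F n" for x
    proof -
      obtain C where "\<forall>i\<in>I. norm (T i x) \<le> C" using assms by blast
      moreover obtain n :: nat where "C \<le> real n" using real_arch_simple by blast
      ultimately show ?thesis unfolding F_def by (intro exI[of _ n]) fastforce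
    qed
    then show ?thesis by blast
  qed
  then have "interior (\<Union>(range F)) \<noteq> {}" by simp
  then obtain n where "interior (F n) \<noteq> {}"
    using Baire_category_alt[of "euclidean :: 'a topology" "range F"] closed
      completely_metrizable_space_euclidean by auto
  then obtain a where "a \<in> interior (F n)" by blast
  then obtain e where e: "e > 0" "cball a e \<subseteq> F n" by (meson mem_interior_cball)
  have "norm (T i) \<le> 2 * real n / e" if "i \<in> I" for i
  proof (rule norm_blinfun_bound)
    fix x
    show "norm (T i x) \<le> 2 * real n / e * norm x"
    proof (cases "x = 0")
      case False
      define y where "y = (e / norm x) *\<^sub>R x"
      have "norm y = e" using False e(1) by (simp add: y_def)
      then have "a + y \<in> F n" "a \<in> F n" using e by (auto simp: dist_norm)
      then have le: "norm (T i (a + y)) \<le> n" "norm (T i a) \<le> n" using that by (auto simp: F_def)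
      have "T i y = T i (a + y) - T i a" by (simp add: blinfun.add_right)
      then have "norm (T i y) \<le> 2 * n"
        using norm_triangle_ineq4[of "T i (a + y)" "T i a"] le by simp
      moreover have "norm (T i y) = e / norm x * norm (T i x)"
        using e(1) by (simp add: y_def blinfun.scaleR_right)
      ultimately show ?thesis using False e(1) by (simp add: field_simps)
    qed simp
  qed (use e in simp)
  then show ?thesis by blast
qed

text \<open>The generator is a limit of quotients; this form lets derivatives of orbits be computed
  by rewriting quotients with the semigroup law.\<close>

lemma has_vector_derivative_iff_quotient:
  fixes f :: "real \<Rightarrow> 'a::real_normed_vector"
  shows "(f has_vector_derivative D) (at x within S) \<longleftrightarrow>
    ((\<lambda>r. (f r - f x) /\<^sub>R (r - x)) \<longlongrightarrow> D) (at x within S)"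
proof -
  have "norm (f r - f x - (r - x) *\<^sub>R D) / norm (r - x) = norm ((f r - f x) /\<^sub>R (r - x) - D)"
    if "r \<noteq> x" for r
  proof -
    have "(f r - f x) /\<^sub>R (r - x) - D = (f r - f x - (r - x) *\<^sub>R D) /\<^sub>R (r - x)"
      using that by (simp add: scaleR_diff_right)
    then show ?thesis by (simp add: divide_inverse mult.commute)
  qed
  then have "((\<lambda>r. norm (f r - f x - (r - x) *\<^sub>R D) / norm (r - x)) \<longlongrightarrow> 0) (at x within S) \<longleftrightarrow>
    ((\<lambda>r. norm ((f r - f x) /\<^sub>R (r - x) - D)) \<longlongrightarrow> 0) (at x within S)"
    by (intro filterlim_cong) (auto simp: eventually_at_filter)
  also have "\<dots> \<longleftrightarrow> ((\<lambda>r. (f r - f x) /\<^sub>R (r - x)) \<longlongrightarrow> D) (at x within S)"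
    by (simp add: tendsto_norm_zero_iff LIM_zero_iff)
  finally show ?thesis
    by (simp add: has_vector_derivative_def has_derivative_iff_norm bounded_linear_scaleR_left)
qed

text \<open>Each orbit is continuous, hence bounded on the compact interval, and the uniform
  boundedness principle makes the bound uniform over the orbits.\<close>

lemma C0_semigroup_bounded:
  assumes "C0_semigroup T"
  obtains M where "M > 0" "\<And>s. 0 \<le> s \<Longrightarrow> s \<le> t \<Longrightarrow> norm (T s) \<le> M"
proof -
  have "\<exists>C. \<forall>s\<in>{0..t}. norm (T s x) \<le> C" for x
  proof -
    have "continuous_on {0..t} (\<lambda>s. T s x)"
      using assms unfolding C0_semigroup_def by (meson atLeastAtMost_iff atLeast_iff continuous_on_subset subsetI)
    then have "compact ((\<lambda>s. T s x) ` {0..t})" by (intro compact_continuous_image) auto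
    then show ?thesis using compact_imp_bounded[THEN bounded_iff[THEN iffD1]] by fastforce
  qed
  then obtain M where "\<forall>s\<in>{0..t}. norm (T s) \<le> M" using banach_steinhaus[of "{0..t}" T] by blast
  then show ?thesis by (intro that[of "max M 1"]) (auto intro: max.coboundedI1)
qed

text \<open>Joint continuity in time and vector, from the splitting
  \<open>T (f r) (v r) = T (f r) (v r - y) + T (f r) y\<close>: local boundedness of the norms sends
  the first term to 0, strong continuity handles the second.\<close>

lemma tendsto_C0_semigroup:
  assumes T: "C0_semigroup T" and s: "s \<ge> 0"
    and f: "(f \<longlongrightarrow> s) F" "eventually (\<lambda>r. f r \<ge> 0) F" and v: "(v \<longlongrightarrow> y) F"
  shows "((\<lambda>r. T (f r) (v r)) \<longlongrightarrow> T s y) F"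
proof -
  obtain M where M: "M > 0" "\<And>r. 0 \<le> r \<Longrightarrow> r \<le> s + 1 \<Longrightarrow> norm (T r) \<le> M"
    using C0_semigroup_bounded[OF T] by blast
  have "eventually (\<lambda>r. f r < s + 1) F" using f(1) by (rule order_tendstoD) simp
  then have "eventually (\<lambda>r. norm (T (f r) (v r - y)) \<le> M * norm (v r - y)) F"
    using f(2)
  proof eventually_elim
    case (elim r)
    then have "norm (T (f r)) * norm (v r - y) \<le> M * norm (v r - y)"
      by (intro mult_right_mono M) auto
    then show ?case using norm_blinfun order_trans by blast
  qed
  moreover have "((\<lambda>r. M * norm (v r - y)) \<longlongrightarrow> 0) F"
    using v by (intro tendsto_mult_right_zero tendsto_norm_zero LIM_zero)
  ultimately have 1: "((\<lambda>r. T (f r) (v r - y)) \<longlongrightarrow> 0) F" by (rule Lim_null_comparison)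
  have "continuous_on {0..} (\<lambda>t. T t y)" using T by (simp add: C0_semigroup_def)
  then have 2: "((\<lambda>r. T (f r) y) \<longlongrightarrow> T s y) F"
    by (rule continuous_on_tendsto_compose) (use f s in auto)
  show ?thesis using tendsto_add[OF 1 2] by (simp add: blinfun.diff_right)
qed

lemma continuous_on_C0_semigroup:
  assumes T: "C0_semigroup T" and "continuous_on S f" "\<And>r. r \<in> S \<Longrightarrow> f r \<ge> 0" "continuous_on S v"
  shows "continuous_on S (\<lambda>r. T (f r) (v r))"
  using assms unfolding continuous_on_def
  by (intro ballI tendsto_C0_semigroup[OF T]) (auto simp: eventually_at_filter)

lemma C0_semigroup_add_apply:
  "C0_semigroup T \<Longrightarrow> s \<ge> 0 \<Longrightarrow> t \<ge> 0 \<Longrightarrow> T (s + t) x = T s (T t x)"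
  by (simp add: C0_semigroup_def)

section \<open>Orbits in the domain and density of the domain\<close>

text \<open>The bounded operator \<open>T s\<close> commutes with \<open>T h\<close>, so it can be
  applied to the limit of quotients that defines \<open>y\<close>.\<close>

lemma generator_orbit:
  assumes T: "C0_semigroup T" and xy: "(x, y) \<in> generator T" and s: "s \<ge> 0"
  shows "(T s x, T s y) \<in> generator T"
proof -
  have q: "((\<lambda>h. (T h x - x) /\<^sub>R h) \<longlongrightarrow> y) (at_right 0)" using xy by (simp add: generator_def)
  have "((\<lambda>h. T s ((T h x - x) /\<^sub>R h)) \<longlongrightarrow> T s y) (at_right 0)"
    using q by (intro tendsto_intros)
  moreover have "eventually (\<lambda>h. T s ((T h x - x) /\<^sub>R h) = (T h (T s x) - T s x) /\<^sub>R h) (at_right 0)"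
    unfolding eventually_at_filter
    by (rule always_eventually)
      (use s C0_semigroup_add_apply[OF T] in \<open>auto simp: blinfun.scaleR_right blinfun.diff_right,
        metis add.commute less_eq_real_def\<close>)
  ultimately show ?thesis by (auto simp: generator_def elim: Lim_transform_eventually)
qed

lemma orbit_has_vector_derivative:
  assumes T: "C0_semigroup T" and xy: "(x, y) \<in> generator T" and s: "s \<ge> 0"
  shows "((\<lambda>r. T r x) has_vector_derivative T s y) (at s within {0..})"
proof -
  have q: "((\<lambda>h. (T h x - x) /\<^sub>R h) \<longlongrightarrow> y) (at_right 0)" using xy by (simp add: generator_def)
  have "filterlim (\<lambda>r. \<bar>r - s\<bar>) (at_right 0) (at s within {0..})"
    unfolding filterlim_at
    by (auto simp: eventually_at_filter intro!: tendsto_eq_intros)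
  \<comment> \<open>Factoring out the orbit at the earlier time \<open>min r s\<close> leaves a
    right-hand quotient at 0 with increment \<open>\<bar>r - s\<bar>\<close>. One limit thus covers
    the derivatives from both sides.\<close>
  from filterlim_compose[OF q this]
  have "((\<lambda>r. T (min r s) ((T \<bar>r - s\<bar> x - x) /\<^sub>R \<bar>r - s\<bar>)) \<longlongrightarrow> T s y) (at s within {0..})"
    by (rule tendsto_C0_semigroup[OF T s, rotated 2])
      (use s in \<open>auto simp: eventually_at_filter intro!: tendsto_eq_intros\<close>)
  moreover have "eventually (\<lambda>r. T (min r s) ((T \<bar>r - s\<bar> x - x) /\<^sub>R \<bar>r - s\<bar>) =
    (T r x - T s x) /\<^sub>R (r - s)) (at s within {0..})"
    unfolding eventually_at_filter
  proof (rule always_eventually, intro allI impI)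
    fix r assume r: "r \<noteq> s" "r \<in> {0..}"
    show "T (min r s) ((T \<bar>r - s\<bar> x - x) /\<^sub>R \<bar>r - s\<bar>) = (T r x - T s x) /\<^sub>R (r - s)"
    proof (cases "r < s")
      case True
      then have "T s x = T r (T (s - r) x)"
        using C0_semigroup_add_apply[OF T, of r "s - r"] r by simp
      moreover have "inverse (s - r) = - inverse (r - s)"
        by (metis inverse_minus_eq minus_diff_eq)
      ultimately show ?thesis using True
        by (simp add: blinfun.scaleR_right blinfun.diff_right scaleR_diff_right)
    next
      case False
      then have "T r x = T s (T (r - s) x)"
        using C0_semigroup_add_apply[OF T, of s "r - s"] s by simp
      then show ?thesis using False
        by (simp add: blinfun.scaleR_right blinfun.diff_right)
    qed
  qed
  ultimately show ?thesis
    unfolding has_vector_derivative_iff_quotient by (rule Lim_transform_eventually)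
qed

text \<open>The means \<open>F h /\<^sub>R h\<close> of the orbit over \<open>[0, h]\<close> lie in
  the domain and tend to \<open>x\<close> as \<open>h\<close> decreases to 0; the sequence takes
  \<open>h = 1 / (n + 1)\<close>.\<close>

lemma generator_domain_dense:
  assumes T: "C0_semigroup T"
  obtains X Y where "X \<longlonglongrightarrow> x" "\<And>n::nat. (X n, Y n) \<in> generator T"
proof -
  define F where "F t = integral {0..t} (\<lambda>s. T s x)" for t
  have cont: "continuous_on {a..b} (\<lambda>s. T s x)" if "0 \<le> a" for a b
    using that by (intro continuous_on_C0_semigroup[OF T] continuous_intros) auto
  have F0: "F 0 = 0" by (simp add: F_def)
  have deriv: "((\<lambda>r. (F (h + r) - F h) /\<^sub>R r) \<longlongrightarrow> T h x) (at_right 0)" if "h \<ge> 0" for h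
  proof -
    have "(F has_vector_derivative T h x) (at h within {0..h+1})"
      unfolding F_def using integral_has_vector_derivative[OF cont, of 0 h "h + 1"] that by simp
    then have "((\<lambda>r. (F r - F h) /\<^sub>R (r - h)) \<longlongrightarrow> T h x) (at h within {0..h+1})"
      by (simp add: has_vector_derivative_iff_quotient)
    moreover have "filterlim (\<lambda>r. h + r) (at h within {0..h+1}) (at_right 0)"
      unfolding filterlim_at
      using that eventually_at_right_real[of 0 1]
      by (auto intro!: tendsto_eq_intros elim!: eventually_mono)
    ultimately show ?thesis using filterlim_compose by fastforce
  qed
  \<comment> \<open>\<open>T r\<close> passes under the integral and shifts its interval to
    \<open>[r, h + r]\<close>.\<close>
  have TF: "T r (F h) = F (h + r) - F r" if "r \<ge> 0" "h \<ge> 0" for r h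
  proof -
    have "T r (F h) = integral {0..h} (\<lambda>s. T r (T s x))"
      unfolding F_def using integral_linear[OF integrable_continuous_real[OF cont] blinfun.bounded_linear_right, of 0 h "T r"]
      by (simp add: o_def)
    also have "\<dots> = integral {0..h} (\<lambda>s. T (s + r) x)"
      using that by (intro integral_cong) (auto simp: C0_semigroup_add_apply[OF T, symmetric] add.commute)
    also have "\<dots> = integral {r..h + r} (\<lambda>s. T s x)"
      using integral_shift_real_ivl[where a = r and c = r and b = "h + r" and f = "\<lambda>s. T s x"] by simp
    also have "\<dots> = F (h + r) - F r"
      using Henstock_Kurzweil_Integration.integral_combine[where a = 0 and c = r and b = "h + r" and f = "\<lambda>s. T s x"] integrable_continuous_real[OF cont, of 0 "h+r"] that
      by (simp add: F_def algebra_simps)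
    finally show ?thesis .
  qed
  \<comment> \<open>By \<open>TF\<close> the generator quotient of \<open>F h\<close> is the
    difference of the right-hand quotients of \<open>F\<close> at \<open>h\<close> and at 0, whose
    limits are \<open>T h x\<close> and \<open>x\<close>.\<close>
  have gen: "(F h /\<^sub>R h, (T h x - x) /\<^sub>R h) \<in> generator T" if "h > 0" for h
  proof -
    have "((\<lambda>r. ((F (h + r) - F h) /\<^sub>R r - (F (0 + r) - F 0) /\<^sub>R r) /\<^sub>R h) \<longlongrightarrow> (T h x - T 0 x) /\<^sub>R h) (at_right 0)"
      using that by (intro tendsto_intros deriv) auto
    moreover have "eventually (\<lambda>r. ((F (h + r) - F h) /\<^sub>R r - (F (0 + r) - F 0) /\<^sub>R r) /\<^sub>R h
        = (T r (F h /\<^sub>R h) - F h /\<^sub>R h) /\<^sub>R r) (at_right 0)"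
      unfolding eventually_at_filter
      by (rule always_eventually)
        (use that in \<open>auto simp: TF F0 blinfun.scaleR_right algebra_simps\<close>)
    moreover have "T 0 x = x" using T by (simp add: C0_semigroup_def)
    ultimately show ?thesis by (auto simp: generator_def elim: Lim_transform_eventually)
  qed
  have "((\<lambda>r. F r /\<^sub>R r) \<longlongrightarrow> x) (at_right 0)"
    using deriv[of 0] T by (simp add: F0 C0_semigroup_def)
  moreover have "filterlim (\<lambda>n. inverse (real (Suc n))) (at_right 0) sequentially"
    unfolding filterlim_at using LIMSEQ_inverse_real_of_nat by auto
  ultimately have "(\<lambda>n. F (inverse (real (Suc n))) /\<^sub>R inverse (real (Suc n))) \<longlonglongrightarrow> x"
    by (rule filterlim_compose)
  then show ?thesis by (rule that) (rule gen, simp)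
qed


section \<open>Duhamel's formula\<close>

text \<open>Integrate the derivative of \<open>g s = T (t - s) (S s x)\<close> from 0 to
  \<open>t\<close>. The orbit \<open>S s x\<close> stays in the common domain of both generators,
  and in the derivative \<open>T (t - s) ((A + B) - A) (S s x)\<close> only \<open>B\<close>
  survives.\<close>

lemma duhamel_generator:
  assumes T: "C0_semigroup T" and S: "C0_semigroup S"
    and gen: "generator S = perturb (generator T) B"
    and xy: "(x, y) \<in> generator T" and t: "t \<ge> 0"
  shows "((\<lambda>s. T (t - s) (B (S s x))) has_integral (S t x - T t x)) {0..t}"
proof -
  define g where "g s = T (t - s) (S s x)" for s
  have xS: "(x, y + B x) \<in> generator S" using xy by (auto simp: gen perturb_def)
  have "(g has_vector_derivative T (t - s) (B (S s x))) (at s within {0..t})" if s: "s \<in> {0..t}" for s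
  proof -
    let ?F = "at s within {0..t}"
    have "(S s x, S s (y + B x)) \<in> generator S" using generator_orbit[OF S xS] s by simp
    then obtain z where z: "(S s x, z) \<in> generator T" "S s (y + B x) = z + B (S s x)"
      by (auto simp: gen perturb_def)
    \<comment> \<open>Product rule by hand: the quotient of \<open>g\<close> splits into
      \<open>T (t - r)\<close> applied to the quotient of \<open>S\<close>, which needs joint
      continuity, and the quotient of \<open>T (t - r)\<close> at the fixed vector
      \<open>S s x\<close>, whose limit is \<open>- T (t - s) z\<close> because time runs
      backwards.\<close>
    have "((\<lambda>r. (S r x - S s x) /\<^sub>R (r - s)) \<longlongrightarrow> z + B (S s x)) ?F"
      using has_vector_derivative_within_subset[OF orbit_has_vector_derivative[OF S xS], of s "{0..t}"] s z(2)
      by (simp add: has_vector_derivative_iff_quotient)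
    then have 1: "((\<lambda>r. T (t - r) ((S r x - S s x) /\<^sub>R (r - s))) \<longlongrightarrow> T (t - s) (z + B (S s x))) ?F"
      by (rule tendsto_C0_semigroup[OF T, rotated 3])
        (use s in \<open>auto simp: eventually_at_filter intro!: tendsto_eq_intros\<close>)
    have "((\<lambda>r. (T r (S s x) - T (t - s) (S s x)) /\<^sub>R (r - (t - s))) \<longlongrightarrow> T (t - s) z) (at (t - s) within {0..})"
      using orbit_has_vector_derivative[OF T z(1), of "t - s"] s
      by (simp add: has_vector_derivative_iff_quotient)
    moreover have "filterlim (\<lambda>r. t - r) (at (t - s) within {0..}) ?F"
      unfolding filterlim_at
      by (auto simp: eventually_at_filter intro!: tendsto_eq_intros)
    ultimately have "((\<lambda>r. (T (t - r) (S s x) - T (t - s) (S s x)) /\<^sub>R ((t - r) - (t - s))) \<longlongrightarrow> T (t - s) z) ?F"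
      by (rule filterlim_compose)
    from tendsto_diff[OF 1 this]
    have "((\<lambda>r. T (t - r) ((S r x - S s x) /\<^sub>R (r - s)) -
      (T (t - r) (S s x) - T (t - s) (S s x)) /\<^sub>R (s - r)) \<longlongrightarrow> T (t - s) (B (S s x))) ?F"
      by (simp add: blinfun.add_right)
    moreover have "T (t - r) ((S r x - S s x) /\<^sub>R (r - s)) -
      (T (t - r) (S s x) - T (t - s) (S s x)) /\<^sub>R (s - r) = (g r - g s) /\<^sub>R (r - s)" for r
    proof -
      have "inverse (s - r) = - inverse (r - s)" by (metis inverse_minus_eq minus_diff_eq)
      then show ?thesis
        by (simp add: g_def blinfun.scaleR_right blinfun.diff_right scaleR_diff_right)
    qed
    ultimately show ?thesis by (simp add: has_vector_derivative_iff_quotient)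
  qed
  then have "((\<lambda>s. T (t - s) (B (S s x))) has_integral (g t - g 0)) {0..t}"
    by (intro fundamental_theorem_of_calculus t)
  then show ?thesis using T S by (simp add: g_def C0_semigroup_def)
qed

text \<open>Both sides depend continuously on \<open>x\<close>, the integral because its integrand
  is at most \<open>K * norm x\<close> uniformly on \<open>[0, t]\<close>. The formula therefore
  extends from the dense domain.\<close>

lemma duhamel:
  assumes T: "C0_semigroup T" and S: "C0_semigroup S"
    and gen: "generator S = perturb (generator T) B" and t: "t \<ge> 0"
  shows "((\<lambda>s. T (t - s) (B (S s x))) has_integral (S t x - T t x)) {0..t}"
proof -
  define f where "f x s = T (t - s) (B (S s x))" for x s
  have cont: "continuous_on {0..t} (f x)" for x
    unfolding f_def
    by (intro continuous_on_C0_semigroup[OF T] continuous_on_C0_semigroup[OF S] continuous_intros) auto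
  have int: "f x integrable_on {0..t}" for x by (rule integrable_continuous_real[OF cont])
  obtain X Y where X: "X \<longlonglongrightarrow> x" "\<And>n. (X n, Y n) \<in> generator T"
    using generator_domain_dense[OF T] by blast
  obtain M where M: "M > 0" "\<And>s. 0 \<le> s \<Longrightarrow> s \<le> t \<Longrightarrow> norm (T s) \<le> M"
    using C0_semigroup_bounded[OF T] by blast
  obtain N where N: "N > 0" "\<And>s. 0 \<le> s \<Longrightarrow> s \<le> t \<Longrightarrow> norm (S s) \<le> N"
    using C0_semigroup_bounded[OF S] by blast
  define K where "K = M * (norm B * N)"
  have bound: "norm (f z s) \<le> K * norm z" if "s \<in> {0..t}" for z s
  proof -
    have "norm (f z s) \<le> norm (T (t - s)) * (norm B * (norm (S s) * norm z))"
      unfolding f_def by (intro order_trans[OF norm_blinfun] mult_left_mono) auto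
    also have "\<dots> \<le> M * (norm B * (N * norm z))"
      using that M N by (intro mult_mono mult_left_mono) auto
    finally show ?thesis by (simp add: K_def mult.assoc)
  qed
  have "integral {0..t} (f (X n)) - integral {0..t} (f x) = integral {0..t} (f (X n - x))" for n
    using integral_diff[OF int int, of "X n" x] by (simp add: f_def[abs_def] blinfun.diff_right)
  then have le: "norm (integral {0..t} (f (X n)) - integral {0..t} (f x)) \<le> K * norm (X n - x) * (t - 0)" for n
    using integral_bound[OF t cont bound] by simp
  have "(\<lambda>n. K * norm (X n - x) * (t - 0)) \<longlonglongrightarrow> 0"
    using X(1) by (intro tendsto_mult_left_zero tendsto_mult_right_zero tendsto_norm_zero LIM_zero)
  then have "(\<lambda>n. integral {0..t} (f (X n)) - integral {0..t} (f x)) \<longlonglongrightarrow> 0"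
    by (rule Lim_null_comparison[OF always_eventually[OF allI[OF le]]])
  then have "(\<lambda>n. integral {0..t} (f (X n))) \<longlonglongrightarrow> integral {0..t} (f x)"
    by (rule LIM_zero_cancel)
  moreover have "integral {0..t} (f (X n)) = S t (X n) - T t (X n)" for n
    using duhamel_generator[OF T S gen X(2) t] by (simp add: f_def[abs_def] integral_unique)
  moreover have "(\<lambda>n. S t (X n) - T t (X n)) \<longlonglongrightarrow> S t x - T t x"
    using X(1) by (intro tendsto_intros)
  ultimately have "integral {0..t} (f x) = S t x - T t x"
    using LIMSEQ_unique by simp
  then show ?thesis using integrable_integral[OF int, of x] by (simp add: f_def[abs_def])
qed


section \<open>The distance to the positive cone\<close>

text \<open>A scalar measure of failing positivity that uses no lattice operations. It also makes
  sense in the complexification, where elements with different imaginary parts have no common upper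
  bound.\<close>

definition cone_dist :: "'a::{real_normed_vector, ordered_real_vector} \<Rightarrow> real" where
  "cone_dist x = infdist x {0..}"

lemma cone_dist_le: "0 \<le> c \<Longrightarrow> cone_dist x \<le> norm (x - c)"
  by (simp add: cone_dist_def infdist_le flip: dist_norm)

lemma cone_dist_approx:
  assumes "e > 0"
  obtains c where "0 \<le> c" "norm (x - c) < cone_dist x + e"
proof -
  have "(INF c\<in>{0..}. dist x c) < cone_dist x + e"
    using assms by (simp add: cone_dist_def infdist_notempty)
  then show ?thesis
    using that by (subst (asm) cINF_less_iff) (auto simp: dist_norm intro!: bdd_belowI[of _ 0])
qed

lemma cone_dist_nonneg [simp]: "0 \<le> cone_dist x"
  by (simp add: cone_dist_def infdist_nonneg)

lemma cone_dist_eq_0: "0 \<le> x \<Longrightarrow> cone_dist x = 0"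
  by (simp add: cone_dist_def)

lemma cone_dist_add: "cone_dist (x + y) \<le> cone_dist x + cone_dist y"
proof (rule field_le_epsilon)
  fix e :: real assume "e > 0"
  then obtain c d where c: "0 \<le> c" "norm (x - c) < cone_dist x + e / 2"
    and d: "0 \<le> d" "norm (y - d) < cone_dist y + e / 2"
    using cone_dist_approx[of "e / 2"] by (metis half_gt_zero)
  have "cone_dist (x + y) \<le> norm ((x - c) + (y - d))"
    using cone_dist_le[of "c + d" "x + y"] c d by (simp add: algebra_simps)
  also have "\<dots> \<le> norm (x - c) + norm (y - d)" by (rule norm_triangle_ineq)
  finally show "cone_dist (x + y) \<le> cone_dist x + cone_dist y + e" using c d by simp
qed

text \<open>If \<open>c\<close> is a nearly closest point of the cone to \<open>x\<close>, then
  \<open>K c\<close> is again in the cone and competes for \<open>K x\<close>.\<close>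

lemma cone_dist_positive_operator:
  assumes "positive_operator K"
  shows "cone_dist (K x) \<le> norm K * cone_dist x"
proof (rule field_le_epsilon)
  fix e :: real assume e: "e > 0"
  \<comment> \<open>The summand 1 keeps the denominator positive when \<open>K\<close> is 0.\<close>
  define e' where "e' = e / (norm K + 1)"
  have K: "norm K + 1 > 0" using norm_ge_zero[of K] by linarith
  then have e': "e' > 0" "norm K * e' \<le> e" using e by (auto simp: e'_def field_simps)
  obtain c where c: "0 \<le> c" "norm (x - c) < cone_dist x + e'"
    using cone_dist_approx e'(1) by blast
  have "cone_dist (K x) \<le> norm (K x - K c)"
    using assms c by (intro cone_dist_le) (simp add: positive_operator_def)
  also have "\<dots> \<le> norm K * norm (x - c)" by (simp add: norm_blinfun flip: blinfun.diff_right)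
  also have "\<dots> \<le> norm K * (cone_dist x + e')" using c by (intro mult_left_mono) auto
  finally show "cone_dist (K x) \<le> norm K * cone_dist x + e" using e' by (simp add: algebra_simps)
qed

text \<open>Multiplication by \<open>a \<ge> 0\<close> is a positive operator of norm at most
  \<open>a\<close>.\<close>

lemma cone_dist_scaleR:
  fixes x :: "'a::{real_normed_vector, ordered_real_vector}"
  assumes "0 \<le> a"
  shows "cone_dist (a *\<^sub>R x) \<le> a * cone_dist x"
proof (rule order_trans)
  let ?K = "blinfun_scaleR_right a :: 'a \<Rightarrow>\<^sub>L 'a"
  have "positive_operator ?K" using assms by (simp add: positive_operator_def scaleR_nonneg_nonneg)
  from cone_dist_positive_operator[OF this, of x]
  show "cone_dist (a *\<^sub>R x) \<le> norm ?K * cone_dist x" by simp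
  have "norm ?K \<le> a" using assms by (intro norm_blinfun_bound) auto
  then show "norm ?K * cone_dist x \<le> a * cone_dist x" by (intro mult_right_mono) auto
qed

lemma cone_dist_sum: "cone_dist (\<Sum>i\<in>I. f i) \<le> (\<Sum>i\<in>I. cone_dist (f i))"
proof (induction I rule: infinite_finite_induct)
  case (insert i I)
  then show ?case using cone_dist_add[of "f i" "sum f I"] by simp
qed (simp_all add: cone_dist_eq_0)

text \<open>Sublinearity gives the inequality for Riemann sums, and the errors of both sums are
  absorbed by \<open>e\<close>. The integrable majorant \<open>\<phi>\<close> spares any
  integrability claim about \<open>cone_dist (f s)\<close>.\<close>

lemma cone_dist_has_integral:
  fixes f :: "real \<Rightarrow> 'a::{real_normed_vector, ordered_real_vector}"
  assumes f: "(f has_integral I) {a..b}" and \<phi>: "(\<phi> has_integral J) {a..b}"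
    and le: "\<And>s. s \<in> {a..b} \<Longrightarrow> cone_dist (f s) \<le> \<phi> s"
  shows "cone_dist I \<le> J"
proof (rule field_le_epsilon)
  fix e :: real assume "e > 0"
  then have e: "e / 2 > 0" by simp
  obtain g where g: "gauge g" "\<And>D :: (real \<times> real set) set. D tagged_division_of {a..b} \<Longrightarrow> g fine D \<Longrightarrow>
      norm ((\<Sum>(x,k)\<in>D. measure lborel k *\<^sub>R f x) - I) < e / 2"
    using f e unfolding has_integral_real by meson
  obtain h where h: "gauge h" "\<And>D :: (real \<times> real set) set. D tagged_division_of {a..b} \<Longrightarrow> h fine D \<Longrightarrow>
      norm ((\<Sum>(x,k)\<in>D. measure lborel k *\<^sub>R \<phi> x) - J) < e / 2"
    using \<phi> e unfolding has_integral_real by meson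
  \<comment> \<open>One division fine for both gauges, so that the two Riemann sums compare term by
    term.\<close>
  obtain D :: "(real \<times> real set) set" where D: "D tagged_division_of {a..b}" "(\<lambda>x. g x \<inter> h x) fine D"
    using fine_division_exists_real[OF gauge_Int[OF g(1) h(1)]] by blast
  define F where "F = (\<Sum>(x,k)\<in>D. measure lborel k *\<^sub>R f x)"
  define P where "P = (\<Sum>(x,k)\<in>D. measure lborel k *\<^sub>R \<phi> x)"
  have FP: "norm (F - I) < e / 2" "norm (P - J) < e / 2"
    using g(2) h(2) D by (auto simp: F_def P_def fine_Int)
  have "cone_dist F \<le> (\<Sum>(x,k)\<in>D. cone_dist (measure lborel k *\<^sub>R f x))"
    unfolding F_def using cone_dist_sum[of "\<lambda>(x,k). measure lborel k *\<^sub>R f x" D]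
    by (simp add: case_prod_unfold)
  also have "\<dots> \<le> P"
    unfolding P_def
  proof (rule sum_mono, clarify)
    fix x k assume "(x, k) \<in> D"
    then have "x \<in> {a..b}" using tag_in_interval[OF D(1)] by blast
    then have "measure lborel k * cone_dist (f x) \<le> measure lborel k * \<phi> x"
      by (intro mult_left_mono le) auto
    then show "cone_dist (measure lborel k *\<^sub>R f x) \<le> measure lborel k *\<^sub>R \<phi> x"
      using cone_dist_scaleR[of "measure lborel k" "f x"] by simp
  qed
  finally have "cone_dist F \<le> P" .
  moreover have "cone_dist I \<le> cone_dist F + cone_dist (I - F)"
    using cone_dist_add[of F "I - F"] by simp
  moreover have "cone_dist (I - F) \<le> norm (F - I)"
    using cone_dist_le[of 0 "I - F"] by (simp add: norm_minus_commute)
  moreover have "P \<le> J + norm (P - J)" by simp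
  ultimately show "cone_dist I \<le> J + e" using FP by linarith
qed


section \<open>Positivity of the perturbation\<close>

text \<open>Stated for an ordered Banach space with closed cone, so that a real Banach lattice and a
  complexification are both instances.\<close>

lemma positive_perturbation:
  fixes T S :: "real \<Rightarrow> 'a::{banach, ordered_real_vector} \<Rightarrow>\<^sub>L 'a"
  assumes cone: "closed {x::'a. 0 \<le> x}"
    and T: "C0_semigroup T" and S: "C0_semigroup S"
    and gen: "generator S = perturb (generator T) B"
    and pos: "\<And>s t. s \<ge> 0 \<Longrightarrow> t \<ge> 0 \<Longrightarrow> positive_operator (T t o\<^sub>L B o\<^sub>L T s)"
    and t: "t \<ge> 0"
  shows "positive_operator (S t - T t)"
  unfolding positive_operator_def
proof (intro allI impI)
  fix x :: 'a assume x: "0 \<le> x"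
  define u where "u s = S s x - T s x" for s
  obtain M where M: "M > 0" "\<And>s. 0 \<le> s \<Longrightarrow> s \<le> t \<Longrightarrow> norm (T s) \<le> M"
    using C0_semigroup_bounded[OF T] by blast
  obtain N where N: "N > 0" "\<And>s. 0 \<le> s \<Longrightarrow> s \<le> t \<Longrightarrow> norm (S s) \<le> N"
    using C0_semigroup_bounded[OF S] by blast
  \<comment> \<open>The summand 1 makes \<open>K\<close> positive even for
    \<open>B = 0\<close>.\<close>
  define K where "K = M * norm B + 1"
  have K: "K > 0" using M(1) by (simp add: K_def add_nonneg_pos)
  \<comment> \<open>A bound for \<open>norm (u s)\<close> on \<open>[0, t]\<close>, hence for the
    cone distance; it starts the iteration.\<close>
  define \<delta> where "\<delta> = (N + M) * norm x"
  have \<delta>: "\<delta> \<ge> 0" using M(1) N(1) by (simp add: \<delta>_def)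
  have integrand: "cone_dist (T (s - r) (B (S r x))) \<le> K * cone_dist (u r)"
    if "0 \<le> r" "r \<le> s" "s \<le> t" for r s
  proof -
    let ?L = "T (s - r) o\<^sub>L B"
    have "0 \<le> ?L (T r x)"
      using pos[of r "s - r"] that x by (simp add: positive_operator_def)
    then have "cone_dist (?L (T r x)) = 0" by (rule cone_dist_eq_0)
    moreover have "positive_operator ?L"
      using pos[of 0 "s - r"] that T by (simp add: positive_operator_def C0_semigroup_def)
    then have "cone_dist (?L (u r)) \<le> norm ?L * cone_dist (u r)"
      by (rule cone_dist_positive_operator)
    moreover have "norm ?L \<le> K"
    proof -
      have "norm ?L \<le> norm (T (s - r)) * norm B" by (rule norm_blinfun_compose)
      also have "\<dots> \<le> M * norm B" using that by (intro mult_right_mono M) auto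
      finally show ?thesis by (simp add: K_def)
    qed
    then have "norm ?L * cone_dist (u r) \<le> K * cone_dist (u r)" by (rule mult_right_mono) simp
    moreover have "?L (S r x) = ?L (T r x) + ?L (u r)"
      by (simp add: u_def blinfun.diff_right)
    then have "cone_dist (?L (S r x)) \<le> cone_dist (?L (T r x)) + cone_dist (?L (u r))"
      by (simp add: cone_dist_add)
    ultimately show ?thesis by simp
  qed
  txt \<open>The weight \<open>exp (2 * K * s)\<close> makes the Volterra equation for \<open>u\<close> a contraction with factor
    \<open>1/2\<close> on the whole interval, so no subdivision of \<open>[0, t]\<close> is needed.\<close>
  have iterate: "cone_dist (u s) \<le> \<delta> / 2 ^ n * exp (2 * K * s)" if "0 \<le> s" "s \<le> t" for n s
    using that
  proof (induction n arbitrary: s)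
    case 0
    have "cone_dist (u s) \<le> norm (u s)" using cone_dist_le[of 0 "u s"] by simp
    also have "\<dots> \<le> norm (S s x) + norm (T s x)" unfolding u_def by (rule norm_triangle_ineq4)
    also have "\<dots> \<le> N * norm x + M * norm x"
      using 0 by (intro add_mono order_trans[OF norm_blinfun] mult_right_mono M N) auto
    also have "\<dots> = \<delta> * 1" by (simp add: \<delta>_def algebra_simps)
    also have "\<dots> \<le> \<delta> * exp (2 * K * s)" using \<delta> K 0 by (intro mult_left_mono) auto
    finally show ?case by simp
  next
    case (Suc n)
    \<comment> \<open>Integrating \<open>K * exp (2 * K * r)\<close> produces the factor 1/2, so
      \<open>c\<close> is half the previous constant. The lower endpoint contributes
      \<open>- c \<le> 0\<close> and is dropped at the end.\<close>
    define c where "c = \<delta> / 2 ^ Suc n"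
    have c: "c \<ge> 0" using \<delta> by (simp add: c_def)
    have "((\<lambda>r. c * (2 * K * exp (2 * K * r))) has_integral (c * exp (2 * K * s) - c * exp (2 * K * 0))) {0..s}"
      using Suc.prems
      by (intro fundamental_theorem_of_calculus)
        (auto intro!: derivative_eq_intros simp flip: has_real_derivative_iff_has_vector_derivative)
    moreover have "((\<lambda>r. T (s - r) (B (S r x))) has_integral u s) {0..s}"
      unfolding u_def by (rule duhamel[OF T S gen Suc.prems(1)])
    moreover have "cone_dist (T (s - r) (B (S r x))) \<le> c * (2 * K * exp (2 * K * r))" if "r \<in> {0..s}" for r
    proof -
      have "cone_dist (T (s - r) (B (S r x))) \<le> K * cone_dist (u r)"
        using that Suc.prems by (intro integrand) auto
      also have "\<dots> \<le> K * (\<delta> / 2 ^ n * exp (2 * K * r))"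
        using that Suc.prems K by (intro mult_left_mono Suc.IH) auto
      finally show ?thesis by (simp add: c_def mult_ac)
    qed
    ultimately have "cone_dist (u s) \<le> c * exp (2 * K * s) - c * exp (2 * K * 0)"
      using cone_dist_has_integral by blast
    then show ?case using c by (simp add: c_def)
  qed
  have "(\<lambda>n. \<delta> / 2 ^ n * exp (2 * K * t)) \<longlonglongrightarrow> 0"
    by (intro tendsto_mult_left_zero LIMSEQ_divide_realpow_zero) simp
  then have "cone_dist (u t) \<le> 0"
    by (rule LIMSEQ_le_const) (use iterate[OF t order_refl] in blast)
  then have "infdist (u t) {0..} = 0"
    by (simp add: cone_dist_def antisym infdist_nonneg)
  moreover have "closed {0::'a..}" using cone by (simp add: atLeast_def)
  ultimately have "u t \<in> {0..}"
    by (subst in_closed_iff_infdist_zero) auto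
  then show "0 \<le> (S t - T t) x" by (simp add: u_def blinfun.diff_left)
qed

text \<open>The cone is cut out by a closed condition on each of the continuous maps
  \<open>re_part\<close> and \<open>im_part\<close>.\<close>

lemma closed_nonneg_complexification:
  "closed {z::'a::banach_lattice complexification. 0 \<le> z}"
proof -
  have "bounded_linear (re_part :: 'a complexification \<Rightarrow> 'a)"
    by (rule bounded_linear_intro[where K = 1]) (simp_all add: complexification_ops norm_re_part_le)
  moreover have "bounded_linear (im_part :: 'a complexification \<Rightarrow> 'a)"
    by (rule bounded_linear_intro[where K = 1]) (simp_all add: complexification_ops norm_im_part_le)
  ultimately have cont: "continuous_on UNIV (re_part :: 'a complexification \<Rightarrow> 'a)"
    "continuous_on UNIV (im_part :: 'a complexification \<Rightarrow> 'a)"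
    by (simp_all add: linear_continuous_on)
  have "{z::'a complexification. 0 \<le> z} = re_part -` {x. 0 \<le> x} \<inter> im_part -` {0}"
    by (auto simp: less_eq_complexification_def zero_complexification_def)
  moreover have "closed (re_part -` {x::'a. 0 \<le> x})"
    by (rule closed_vimage[OF closed_nonneg_banach_lattice cont(1)])
  moreover have "closed (im_part -` {0::'a})"
    by (rule closed_vimage[OF closed_singleton cont(2)])
  ultimately show ?thesis by (simp only: closed_Int)
qed

theorem proposition5p1:
  shows
    "(\<forall>(A :: ('a::banach_lattice \<times> 'a) set) B T S.
        generates A T \<longrightarrow>
        generates (perturb A B) S \<longrightarrow>
        (\<forall>s\<ge>0. \<forall>t\<ge>0. positive_operator (T t o\<^sub>L B o\<^sub>L T s)) \<longrightarrow>
        (\<forall>t\<ge>0. positive_operator (S t - T t)))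
     \<and>
     (\<forall>(A :: ('b::banach_lattice complexification \<times> 'b complexification) set) B T S.
        generates A T \<longrightarrow> (\<forall>t\<ge>0. complex_linear (T t)) \<longrightarrow>
        complex_linear B \<longrightarrow>
        generates (perturb A B) S \<longrightarrow> (\<forall>t\<ge>0. complex_linear (S t)) \<longrightarrow>
        (\<forall>s\<ge>0. \<forall>t\<ge>0. positive_operator (T t o\<^sub>L B o\<^sub>L T s)) \<longrightarrow>
        (\<forall>t\<ge>0. positive_operator (S t - T t)))"
proof (intro conjI allI impI)
  fix A :: "('a \<times> 'a) set" and B T S and t :: real
  assume T: "generates A T" and S: "generates (perturb A B) S" and t: "t \<ge> 0"
    and pos: "\<forall>s\<ge>0. \<forall>t\<ge>0. positive_operator (T t o\<^sub>L B o\<^sub>L T s)"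
  have "C0_semigroup T" "C0_semigroup S" "generator S = perturb (generator T) B"
    using T S unfolding generates_def by blast+
  then show "positive_operator (S t - T t)"
    by (rule positive_perturbation[OF closed_nonneg_banach_lattice _ _ _ pos[rule_format] t])
next
  fix A :: "('b complexification \<times> 'b complexification) set" and B T S and t :: real
  assume T: "generates A T" and S: "generates (perturb A B) S" and t: "t \<ge> 0"
    and pos: "\<forall>s\<ge>0. \<forall>t\<ge>0. positive_operator (T t o\<^sub>L B o\<^sub>L T s)"
  have "C0_semigroup T" "C0_semigroup S" "generator S = perturb (generator T) B"
    using T S unfolding generates_def by blast+
  then show "positive_operator (S t - T t)"
    by (rule positive_perturbation[OF closed_nonneg_complexification _ _ _ pos[rule_format] t])
qed

end
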